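(* Let $(A,\langle\cdot,\cdot\rangle)$ be a finite-dimensional symmetric Frobenius algebra over a field $\mathbf{k}$ of characteristic zero. For all $p,q\ge0$, $$[\mathrm{C}^p_{rb}(A),\mathrm{C}^q_{rb}(A)]_{rb}\subseteq\mathrm{C}^{p+q}_{rb}(A).$$ Consequently, $(\mathrm{C}^\bullet_{rb}(A),[\cdot,\cdot]_{rb})$ is a graded Lie subalgebra of $\bigl(\bigoplus_{n\ge0}\mathrm{Hom}(A^{\otimes n},A),[\cdot,\cdot]_{rb}\bigr)$.
   Context: A symmetric Frobenius algebra is an associative algebra $A$ with a non-degenerate symmetric bilinear form $\langle\cdot,\cdot\rangle$ that is invariant: $\langle xy,z\rangle=\langle x,yz\rangle$. For $p\ge0$ (with $\mathrm{Hom}(A^{\otimes0},A)=A$), $\mathrm{C}^p_{rb}(A)$ is the space of $F\in\mathrm{Hom}(A^{\otimes p},A)$ with $\langle F(x_1,\dots,x_p),x_0\rangle=(-1)^p\langle F(x_0,\dots,x_{p-1}),x_p\rangle$ for all $x_0,\dots,x_p\in A$; $\mathrm{C}^0_{rb}(A)=A$, elements of $\mathrm{C}^p_{rb}(A)$ have degree $p$, and $\mathrm{C}^\bullet_{rb}(A)=\bigoplus_{p\ge0}\mathrm{C}^p_{rb}(A)$. The bracket $[\cdot,\cdot]_{rb}$ on $\bigoplus_{n\ge0}\mathrm{Hom}(A^{\otimes n},A)$ (a known graded Lie bracket) is defined as follows. For $F\in\mathrm{Hom}(A^{\otimes p},A)$, $G\in\mathrm{Hom}(A^{\otimes q},A)$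 with $p,q\ge1$, $[F,G]_{rb}:=F\circledcirc G-(-1)^{pq}G\circledcirc F$, where $$\begin{aligned}(F\circledcirc G)(x_1,\dots,x_{p+q})=&\sum_{i=1}^p(-1)^{(i-1)q}F(x_1,\dots,x_{i-1},G(x_i,\dots,x_{i+q-1})x_{i+q},x_{i+q+1},\dots,x_{p+q})\\&-\sum_{i=1}^p(-1)^{iq}F(x_1,\dots,x_{i-1},x_iG(x_{i+1},\dots,x_{i+q}),x_{i+q+1},\dots,x_{p+q})\\&+(-1)^{pq}F(x_1,\dots,x_p)G(x_{p+1},\dots,x_{p+q}).\end{aligned}$$ For $a\in A$ and $F\in\mathrm{Hom}(A^{\otimes p},A)$, $p\ge1$, $[F,a]_{rb}(x_1,\dots,x_p)=\sum_{i=1}^pF(x_1,\dots,x_{i-1},ax_i-x_ia,x_{i+1},\dots,x_p)+F(x_1,\dots,x_p)a-aF(x_1,\dots,x_p)$ and $[a,F]_{rb}=-[F,a]_{rb}$. For $a,b\in A$, $[a,b]_{rb}=ab-ba$. *)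

theory Defs
  imports Complex_Main "HOL-Library.Function_Algebras"
begin

text \<open>
  Associative algebras are not required to be unital; unital algebras are a special case
  (class \<open>ring_1\<close> is contained in class \<open>ring\<close>).
\<close>

locale assoc_algebra = vector_space scale
  for scale :: "'k::field \<Rightarrow> 'a::ring \<Rightarrow> 'a" +
  assumes mult_scale_left: "scale c x * y = scale c (x * y)"
    and mult_scale_right: "x * scale c y = scale c (x * y)"

locale symmetric_frobenius_algebra = assoc_algebra scale
  for scale :: "'k::field \<Rightarrow> 'a::ring \<Rightarrow> 'a" +
  fixes form :: "'a \<Rightarrow> 'a \<Rightarrow> 'k"
  assumes form_linear_left: "Vector_Spaces.linear scale (*) (\<lambda>x. form x y)"
    and form_linear_right: "Vector_Spaces.linear scale (*) (form x)"
    and form_sym: "form x y = form y x"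
    and form_invariant: "form (x * y) z = form x (y * z)"
    and form_nondegenerate: "(\<And>y. form x y = 0) \<Longrightarrow> x = 0"

text \<open>
  An element of \<open>Hom(A\<^sup>\<otimes>\<^sup>n, A)\<close> is an \<open>n\<close>-linear map, encoded as a function on lists that is
  extended by zero to the lists of length different from \<open>n\<close>. All of these spaces thereby become
  subspaces of \<open>'a list \<Rightarrow> 'a\<close> with pointwise operations, and their sum in it is direct, so that
  \<open>\<Oplus>\<^sub>n Hom(A\<^sup>\<otimes>\<^sup>n, A)\<close> is the span of their union. For \<open>n = 0\<close> the map
  \<open>F\<close> is identified with the element \<open>F []\<close> of \<open>A\<close>.
\<close>

definition fscale :: "('k \<Rightarrow> 'a \<Rightarrow> 'a) \<Rightarrow> 'k \<Rightarrow> ('a list \<Rightarrow> 'a) \<Rightarrow> 'a list \<Rightarrow> 'a" where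
  "fscale scale c F = (\<lambda>xs. scale c (F xs))"

definition Hom :: "('k::field \<Rightarrow> 'a::ring \<Rightarrow> 'a) \<Rightarrow> nat \<Rightarrow> ('a list \<Rightarrow> 'a) set" where
  "Hom scale n = {F.
     (\<forall>us vs. length us + 1 + length vs = n \<longrightarrow>
        Vector_Spaces.linear scale scale (\<lambda>x. F (us @ [x] @ vs))) \<and>
     (\<forall>xs. length xs \<noteq> n \<longrightarrow> F xs = 0)}"

text \<open>In the cyclicity condition the list \<open>xs\<close> is \<open>x\<^sub>0, \<dots>, x\<^sub>p\<close>.\<close>

definition Crb ::
    "('k::field \<Rightarrow> 'a::ring \<Rightarrow> 'a) \<Rightarrow> ('a \<Rightarrow> 'a \<Rightarrow> 'k) \<Rightarrow> nat \<Rightarrow> ('a list \<Rightarrow> 'a) set" where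
  "Crb scale form p = {F \<in> Hom scale p. \<forall>xs. length xs = p + 1 \<longrightarrow>
     form (F (tl xs)) (hd xs) = (-1) ^ p * form (F (butlast xs)) (last xs)}"

text \<open>
  Below, \<open>xs\<close> is \<open>x\<^sub>1, \<dots>, x\<^sub>n\<close>; since lists are indexed from \<open>0\<close>, the entry \<open>x\<^sub>i\<close> is \<open>xs ! (i - 1)\<close>,
  and the segment \<open>x\<^sub>i, \<dots>, x\<^sub>i\<^sub>+\<^sub>q\<^sub>-\<^sub>1\<close> is \<open>take q (drop (i - 1) xs)\<close>.
\<close>

definition rb_circ :: "('k::field \<Rightarrow> 'a::ring \<Rightarrow> 'a) \<Rightarrow> nat \<Rightarrow> nat \<Rightarrow>
    ('a list \<Rightarrow> 'a) \<Rightarrow> ('a list \<Rightarrow> 'a) \<Rightarrow> 'a list \<Rightarrow> 'a" where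
  "rb_circ scale p q F G xs =
     (\<Sum>i=1..p. scale ((-1) ^ ((i - 1) * q))
        (F (take (i - 1) xs @ [G (take q (drop (i - 1) xs)) * xs ! (i + q - 1)] @ drop (i + q) xs)))
   - (\<Sum>i=1..p. scale ((-1) ^ (i * q))
        (F (take (i - 1) xs @ [xs ! (i - 1) * G (take q (drop i xs))] @ drop (i + q) xs)))
   + scale ((-1) ^ (p * q)) (F (take p xs) * G (drop p xs))"

definition rb_act :: "nat \<Rightarrow> ('a::ring list \<Rightarrow> 'a) \<Rightarrow> 'a \<Rightarrow> 'a list \<Rightarrow> 'a" where
  "rb_act p F a xs =
     (\<Sum>i=1..p. F (take (i - 1) xs @ [a * xs ! (i - 1) - xs ! (i - 1) * a] @ drop i xs))
     + F xs * a - a * F xs"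

text \<open>The bracket of \<open>F \<in> Hom(A\<^sup>\<otimes>\<^sup>p, A)\<close> and \<open>G \<in> Hom(A\<^sup>\<otimes>\<^sup>q, A)\<close>.\<close>

definition rb_bracket_hom :: "('k::field \<Rightarrow> 'a::ring \<Rightarrow> 'a) \<Rightarrow> nat \<Rightarrow> nat \<Rightarrow>
    ('a list \<Rightarrow> 'a) \<Rightarrow> ('a list \<Rightarrow> 'a) \<Rightarrow> 'a list \<Rightarrow> 'a" where
  "rb_bracket_hom scale p q F G = (\<lambda>xs.
     if length xs \<noteq> p + q then 0
     else if p = 0 \<and> q = 0 then F [] * G [] - G [] * F []
     else if q = 0 then rb_act p F (G []) xs
     else if p = 0 then - rb_act q G (F []) xs
     else rb_circ scale p q F G xs - scale ((-1) ^ (p * q)) (rb_circ scale q p G F xs))"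

text \<open>
  The biadditive extension of the bracket to the direct sum: the component of degree \<open>n\<close> of the
  bracket of \<open>F\<close> and \<open>G\<close> is the sum of the brackets of the components of \<open>F\<close> of degree \<open>p\<close> and
  of \<open>G\<close> of degree \<open>n - p\<close>, for \<open>p \<le> n\<close>.
\<close>

definition component :: "nat \<Rightarrow> ('a list \<Rightarrow> 'a::zero) \<Rightarrow> 'a list \<Rightarrow> 'a" where
  "component n F = (\<lambda>xs. if length xs = n then F xs else 0)"

definition rb_bracket :: "('k::field \<Rightarrow> 'a::ring \<Rightarrow> 'a) \<Rightarrow>
    ('a list \<Rightarrow> 'a) \<Rightarrow> ('a list \<Rightarrow> 'a) \<Rightarrow> 'a list \<Rightarrow> 'a" where
  "rb_bracket scale F G = (\<lambda>xs. let n = length xs in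
     \<Sum>p\<le>n. rb_bracket_hom scale p (n - p) (component p F) (component (n - p) G) xs)"

text \<open>
  A graded Lie algebra is given by its homogeneous components \<open>L n\<close>, subspaces of an ambient vector
  space whose sum is direct, and a bracket on \<open>\<Oplus>\<^sub>n L n\<close>; the values of \<open>br\<close> outside
  this direct sum are irrelevant.
\<close>

locale graded_lie_algebra = vector_space scale
  for scale :: "'k::field \<Rightarrow> 'v::ab_group_add \<Rightarrow> 'v" +
  fixes L :: "nat \<Rightarrow> 'v set" and br :: "'v \<Rightarrow> 'v \<Rightarrow> 'v"
  assumes subspace_L: "subspace (L n)"
    and direct: "\<lbrakk>finite N; \<And>n. n \<in> N \<Longrightarrow> c n \<in> L n; (\<Sum>n\<in>N. c n) = 0; m \<in> N\<rbrakk> \<Longrightarrow> c m = 0"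
    and br_add_left: "\<lbrakk>x \<in> span (\<Union>n. L n); y \<in> span (\<Union>n. L n); z \<in> span (\<Union>n. L n)\<rbrakk>
          \<Longrightarrow> br (x + y) z = br x z + br y z"
    and br_add_right: "\<lbrakk>x \<in> span (\<Union>n. L n); y \<in> span (\<Union>n. L n); z \<in> span (\<Union>n. L n)\<rbrakk>
          \<Longrightarrow> br x (y + z) = br x y + br x z"
    and br_scale_left: "\<lbrakk>x \<in> span (\<Union>n. L n); y \<in> span (\<Union>n. L n)\<rbrakk>
          \<Longrightarrow> br (scale a x) y = scale a (br x y)"
    and br_scale_right: "\<lbrakk>x \<in> span (\<Union>n. L n); y \<in> span (\<Union>n. L n)\<rbrakk>
          \<Longrightarrow> br x (scale a y) = scale a (br x y)"
    and br_graded: "\<lbrakk>x \<in> L p; y \<in> L q\<rbrakk> \<Longrightarrow> br x y \<in> L (p + q)"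
    and br_antisym: "\<lbrakk>x \<in> L p; y \<in> L q\<rbrakk> \<Longrightarrow> br x y = - scale ((-1) ^ (p * q)) (br y x)"
    and br_jacobi: "\<lbrakk>x \<in> L p; y \<in> L q; z \<in> L r\<rbrakk> \<Longrightarrow>
          br x (br y z) = br (br x y) z + scale ((-1) ^ (p * q)) (br y (br x z))"

text \<open>The direct sum of the \<open>M n\<close> is a graded Lie subalgebra of the direct sum of the \<open>L n\<close>.\<close>

locale graded_lie_subalgebra = graded_lie_algebra scale L br
  for scale :: "'k::field \<Rightarrow> 'v::ab_group_add \<Rightarrow> 'v" and L br +
  fixes M :: "nat \<Rightarrow> 'v set"
  assumes subspace_M: "subspace (M n)"
    and M_subset: "M n \<subseteq> L n"
    and M_closed: "\<lbrakk>x \<in> span (\<Union>n. M n); y \<in> span (\<Union>n. M n)\<rbrakk> \<Longrightarrow> br x y \<in> span (\<Union>n. M n)"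

lemma component_Hom:
  assumes "F \<in> Hom scale p"
  shows "component n F = (if n = p then F else (\<lambda>_. 0))"
  using assms by (auto simp: component_def Hom_def fun_eq_iff)

lemma Hom_zero_entry:
  assumes "F \<in> Hom scale p" and "length us + 1 + length vs = p"
  shows "F (us @ 0 # vs) = 0"
proof -
  have "Vector_Spaces.linear scale scale (\<lambda>x. F (us @ [x] @ vs))"
    using assms by (simp add: Hom_def)
  then interpret Vector_Spaces.linear scale scale "\<lambda>x. F (us @ [x] @ vs)" .
  show ?thesis using zero by simp
qed

lemma rb_circ_zero_right:
  assumes "vector_space scale" and "F \<in> Hom scale p" and "length xs = p + q"
  shows "rb_circ scale p q F (\<lambda>_. 0) xs = 0"
proof -
  interpret vector_space scale by fact
  have "F (take (i - 1) xs @ 0 # drop (i + q) xs) = 0" if "i \<in> {1..p}" for i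
    using that assms(3) by (intro Hom_zero_entry[OF assms(2)]) auto
  then show ?thesis
    by (simp add: rb_circ_def)
qed

lemma rb_act_zero_right:
  assumes "F \<in> Hom scale p" and "length xs = p"
  shows "rb_act p F 0 xs = 0"
proof -
  have "F (take (i - 1) xs @ 0 # drop i xs) = 0" if "i \<in> {1..p}" for i
    using that assms(2) by (intro Hom_zero_entry[OF assms(1)]) auto
  then show ?thesis
    by (simp add: rb_act_def)
qed

lemma rb_bracket_hom_zero_left:
  assumes "vector_space scale" and "G \<in> Hom scale q"
  shows "rb_bracket_hom scale p q (\<lambda>_. 0) G = (\<lambda>_. 0)"
proof -
  interpret vector_space scale by fact
  have 1: "rb_circ scale p q (\<lambda>_. 0) G xs = 0" for xs
    by (simp add: rb_circ_def)
  have 2: "rb_circ scale q p G (\<lambda>_. 0) xs = 0" if "length xs = p + q" for xs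
    using that by (intro rb_circ_zero_right assms) simp
  have 3: "rb_act q G 0 xs = 0" if "length xs = q" for xs
    using that by (rule rb_act_zero_right[OF assms(2)])
  have 4: "rb_act p (\<lambda>_. 0) a xs = 0" for a xs
    by (simp add: rb_act_def)
  show ?thesis
    by (auto simp: rb_bracket_hom_def fun_eq_iff 1 2 3 4)
qed

lemma rb_bracket_homogeneous:
  fixes scale :: "'k::field \<Rightarrow> 'a::ring \<Rightarrow> 'a"
  assumes "vector_space scale" and F: "F \<in> Hom scale p" and G: "G \<in> Hom scale q"
  shows "rb_bracket scale F G = rb_bracket_hom scale p q F G"
proof
  fix xs :: "'a list"
  have comp: "rb_bracket_hom scale m n (component m F) (component n G) xs =
      (if m = p \<and> n = q then rb_bracket_hom scale p q F G xs else 0)"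
    if "length xs = m + n" for m n
  proof (cases "m = p")
    case False
    have "(\<lambda>_. 0) \<in> Hom scale n"
      using F G assms(1)
      by (auto simp: Hom_def Vector_Spaces.linear_def module_hom_def module_hom_axioms_def
          module.scale_zero_right module_iff_vector_space)
    then show ?thesis
      using False that by (simp add: component_Hom[OF F] component_Hom[OF G]
          rb_bracket_hom_zero_left[OF assms(1) G] rb_bracket_hom_zero_left[OF assms(1)])
  next
    case True
    interpret vector_space scale by fact
    show ?thesis
    proof (cases "n = q")
      case False
      have 1: "rb_circ scale p n F (\<lambda>_. 0) xs = 0"
        using that True by (intro rb_circ_zero_right assms) simp
      have 2: "rb_circ scale n p (\<lambda>_. 0) F xs = 0"
        by (simp add: rb_circ_def)
      have 3: "rb_act p F 0 xs = 0" if "n = 0"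
        using that \<open>length xs = m + n\<close> True by (intro rb_act_zero_right[OF F]) simp
      have 4: "rb_act n (\<lambda>_. 0) a xs = 0" for a
        by (simp add: rb_act_def)
      show ?thesis
        using True False by (auto simp: component_Hom[OF F] component_Hom[OF G]
            rb_bracket_hom_def 1 2 3 4)
    qed (use True in \<open>simp add: component_Hom[OF F] component_Hom[OF G]\<close>)
  qed
  have "rb_bracket scale F G xs =
      (\<Sum>m\<le>length xs. if m = p \<and> length xs - m = q then rb_bracket_hom scale p q F G xs else 0)"
    unfolding rb_bracket_def Let_def by (intro sum.cong refl comp) auto
  also have "\<dots> = (\<Sum>m\<le>length xs. if m = p then
      (if length xs = p + q then rb_bracket_hom scale p q F G xs else 0) else 0)"
    by (intro sum.cong) auto
  also have "\<dots> = rb_bracket_hom scale p q F G xs"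
    by (auto simp: rb_bracket_hom_def)
  finally show "rb_bracket scale F G xs = rb_bracket_hom scale p q F G xs" .
qed

end

theory Submission
  imports Defs
begin

text \<open>
  Three cochain operations explain the bracket: the cup product
  \<open>(F \<smile> G)(u v) = F(u) G(v)\<close>, the Gerstenhaber insertion \<open>\<phi> \<circ> \<alpha>\<close>, which is the signed sum of all
  ways to feed a segment of the arguments of \<open>\<phi>\<close> through \<open>\<alpha>\<close>, and the graded cup commutator
  \<open>\<delta>G = G \<smile> id - (-1)\<^sup>q id \<smile> G\<close> with the identity cochain. For \<open>F\<close> and \<open>G\<close> of degrees \<open>p\<close> and \<open>q\<close>,
  \<open>F \<circledcirc> G = F \<circ> \<delta>G + (-1)\<^sup>p\<^sup>q F \<smile> G\<close>, and \<open>[F, G] = F \<circledcirc> G - (-1)\<^sup>p\<^sup>q G \<circledcirc> F\<close>. This remains true when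
  \<open>p = 0\<close> or \<open>q = 0\<close>, so that the case distinction in the bracket disappears
  (lemma \<open>rb_bracket_hom_eq_rb_commutator\<close>).

  Jacobi identity. The operator \<open>\<phi> \<mapsto> \<phi> \<circ> \<alpha>\<close> is a graded derivation of the cup product, and the graded
  commutator of two such operators is again one of them (lemma \<open>insertion_commutator\<close>).
  Since \<open>id \<circ> \<alpha> = \<alpha>\<close>, applying the derivations to \<open>\<delta>F\<close> and \<open>\<delta>G\<close> gives
  \<open>\<delta>[F, G] = \<delta>F \<circ> \<delta>G - (-1)\<^sup>p\<^sup>q \<delta>G \<circ> \<delta>F\<close> (lemma \<open>ad_id_rb_commutator\<close>). Hence \<open>\<circledcirc>\<close> is a graded right
  pre-Lie product (lemma \<open>rb_product_pre_Lie\<close>), and the commutator of such a product satisfies the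
  graded Jacobi identity.

  Closedness of the cyclic cochains. Write \<open>m = p + q\<close> and put \<open>\<langle>[F, G](x\<^sub>1, \<dots>, x\<^sub>m), x\<^sub>0\<rangle>\<close> on the
  \<open>m + 1\<close> places of a circle. When \<open>F\<close> and \<open>G\<close> are cyclic, invariance of the form turns every summand
  into \<open>\<langle>F(u), G(v) w\<rangle>\<close> or \<open>\<langle>F(u), w G(v)\<rangle>\<close>, where \<open>u\<close>, \<open>v\<close>, \<open>w\<close> are consecutive arcs
  (\<open>u\<close>, \<open>v\<close>, \<open>w\<close> or \<open>u\<close>, \<open>w\<close>, \<open>v\<close> in cyclic order) that together fill the circle. The summands of \<open>F \<circledcirc> G\<close>
  are those in which the arc of \<open>G\<close> together with \<open>w\<close> is not cut by the starting point,
  except for the one boundary term that the definition of \<open>\<circledcirc>\<close> omits; the summands of \<open>G \<circledcirc> F\<close> are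
  exactly the remaining rotations. So the whole expression is a signed sum over all rotations
  (lemma \<open>pairing_rb_commutator\<close>), and a sum over all rotations is visibly cyclic
  (lemma \<open>cyclic_sum_rotate1\<close>).
\<close>

section \<open>Signs and insertions\<close>

definition signed :: "nat \<Rightarrow> 'b::ab_group_add \<Rightarrow> 'b" where
  "signed k x = (if even k then x else - x)"

lemma signed_0 [simp]: "signed k 0 = 0"
  by (simp add: signed_def)

lemma signed_add: "signed k (x + y) = signed k x + signed k y"
  by (simp add: signed_def)

lemma signed_diff: "signed k (x - y) = signed k x - signed k y"
  by (simp add: signed_def)

lemma signed_signed: "signed k (signed l x) = signed (k + l) x"
  by (simp add: signed_def)

lemma signed_sum: "signed k (sum f A) = (\<Sum>i\<in>A. signed k (f i))"
  by (simp add: signed_def sum_negf)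

text \<open>
  Concentration in one arity is kept separate from multilinearity because the functions
  \<open>\<lambda>ys. \<phi> (x # ys)\<close>, over which the inductions run, preserve the latter without any bookkeeping.
\<close>

definition arity :: "nat \<Rightarrow> ('a list \<Rightarrow> 'b::zero) \<Rightarrow> bool" where
  "arity n F \<longleftrightarrow> (\<forall>xs. length xs \<noteq> n \<longrightarrow> F xs = 0)"

lemma arityD: "arity n F \<Longrightarrow> length xs \<noteq> n \<Longrightarrow> F xs = 0"
  by (simp add: arity_def)

text \<open>
  Gerstenhaber's circle product \<open>\<phi> \<circ> \<alpha>\<close> for \<open>\<alpha>\<close> of arity \<open>d + 1\<close>: one segment of \<open>d + 1\<close> consecutive
  arguments is replaced by its value under \<open>\<alpha>\<close>, with sign \<open>(-1)\<^sup>d\<close> for each argument passed over. The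
  recursion separates the insertion at the front from the later ones, which makes identities provable
  by induction on the list of arguments. Near the end of the list too few arguments are
  left; the corresponding terms contain \<open>\<alpha>\<close> on a list of wrong length and vanish as soon as \<open>\<alpha>\<close> has
  arity \<open>d + 1\<close> and \<open>\<phi>\<close> is multilinear.
\<close>

primrec insertion ::
    "nat \<Rightarrow> ('a list \<Rightarrow> 'a) \<Rightarrow> ('a list \<Rightarrow> 'b::ab_group_add) \<Rightarrow> 'a list \<Rightarrow> 'b" where
  "insertion d \<alpha> \<phi> [] = 0"
| "insertion d \<alpha> \<phi> (x # xs) =
     \<phi> (\<alpha> (x # take d xs) # drop d xs) + signed d (insertion d \<alpha> (\<lambda>ys. \<phi> (x # ys)) xs)"

lemma insertion_add:
  "insertion d \<alpha> (\<lambda>xs. \<phi> xs + \<chi> xs) xs = insertion d \<alpha> \<phi> xs + insertion d \<alpha> \<chi> xs"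
  by (induction xs arbitrary: \<phi> \<chi>) (simp_all add: signed_add)

lemma insertion_signed: "insertion d \<alpha> (\<lambda>xs. signed k (\<phi> xs)) xs = signed k (insertion d \<alpha> \<phi> xs)"
  by (induction xs arbitrary: \<phi>) (simp_all add: signed_def)

lemma insertion_diff:
  "insertion d \<alpha> (\<lambda>xs. \<phi> xs - \<chi> xs) xs = insertion d \<alpha> \<phi> xs - insertion d \<alpha> \<chi> xs"
  by (induction xs arbitrary: \<phi> \<chi>) (simp_all add: signed_diff)

lemma insertion_eq_0:
  assumes "\<And>x ys. \<phi> (x # ys) = 0"
  shows "insertion d \<alpha> \<phi> xs = 0"
  using assms by (induction xs arbitrary: \<phi>) simp_all

lemma insertion_mult_right:
  "insertion d \<alpha> (\<lambda>xs. \<phi> xs * c) xs = insertion d \<alpha> \<phi> xs * (c :: 'b::ring)"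
  by (induction xs arbitrary: \<phi>) (simp_all add: signed_def algebra_simps)

lemma insertion_mult_left:
  "insertion d \<alpha> (\<lambda>xs. c * \<phi> xs) xs = (c :: 'b::ring) * insertion d \<alpha> \<phi> xs"
  by (induction xs arbitrary: \<phi>) (simp_all add: signed_def algebra_simps)

text \<open>
  The graded Leibniz rule in its general form: for a function that treats its first \<open>p\<close> arguments and the
  rest separately, the segment replaced by \<open>\<alpha>\<close> lies in one of the two parts. A segment straddling
  the cut between the parts does not occur, because the cut is made after the insertion.
\<close>

lemma insertion_split:
  assumes "\<And>us vs. length us \<noteq> p \<Longrightarrow> \<psi> us vs = 0"
  shows "insertion d \<alpha> (\<lambda>xs. \<psi> (take p xs) (drop p xs)) xs =
    insertion d \<alpha> (\<lambda>us. \<psi> us (drop (p + d) xs)) (take (p + d) xs)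
    + signed (p * d) (insertion d \<alpha> (\<psi> (take p xs)) (drop p xs))"
  using assms
proof (induction xs arbitrary: p \<psi>)
  case (Cons x xs)
  show ?case
  proof (cases p)
    case 0
    then show ?thesis
      using Cons.prems by (simp add: insertion_eq_0 signed_def)
  next
    case (Suc p')
    have IH: "insertion d \<alpha> (\<lambda>xs. \<psi> (x # take p' xs) (drop p' xs)) xs =
        insertion d \<alpha> (\<lambda>us. \<psi> (x # us) (drop (p' + d) xs)) (take (p' + d) xs)
        + signed (p' * d) (insertion d \<alpha> (\<psi> (x # take p' xs)) (drop p' xs))"
      using Cons.prems Suc by (intro Cons.IH) simp
    show ?thesis
      by (simp add: Suc IH signed_add signed_signed drop_take min_def add.commute)
  qed
qed simp

text \<open>
  The closed form of the recursion, for the comparison with the explicit sums of the bracket.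
\<close>

lemma insertion_sum:
  "insertion d \<alpha> \<phi> xs =
    (\<Sum>i<length xs. signed (i * d) (\<phi> (take i xs @ \<alpha> (take (Suc d) (drop i xs)) # drop (Suc (i + d)) xs)))"
proof (induction xs arbitrary: \<phi>)
  case (Cons x xs)
  show ?case
    by (simp add: Cons.IH sum.lessThan_Suc_shift signed_sum signed_signed del: sum.lessThan_Suc)
      (simp add: signed_def)
qed simp

definition multilinear :: "('k \<Rightarrow> 'a \<Rightarrow> 'a) \<Rightarrow> ('a::ab_group_add list \<Rightarrow> 'a) \<Rightarrow> bool" where
  "multilinear scale F \<longleftrightarrow> (\<forall>us vs x y c.
     F (us @ (x + scale c y) # vs) = F (us @ x # vs) + scale c (F (us @ y # vs)))"

lemma multilinear_Cons: "multilinear scale F \<Longrightarrow> multilinear scale (\<lambda>xs. F (x # xs))"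
  unfolding multilinear_def by (metis append_Cons)

context vector_space
begin

lemma scale_sign: "scale ((- 1) ^ k) x = signed k x"
  by (simp add: signed_def)

lemma scale_signed: "scale c (signed k x) = signed k (scale c x)"
  by (simp add: signed_def)

lemma multilinearD:
  "multilinear scale F \<Longrightarrow>
    F (us @ (x + scale c y) # vs) = F (us @ x # vs) + scale c (F (us @ y # vs))"
  by (simp add: multilinear_def)

lemma multilinear_zero:
  assumes "multilinear scale F" shows "F (us @ 0 # vs) = 0"
  using multilinearD[OF assms, of us 0 1 0 vs] by simp

lemma multilinear_add:
  assumes "multilinear scale F" shows "F (us @ (x + y) # vs) = F (us @ x # vs) + F (us @ y # vs)"
  using multilinearD[OF assms, of us x 1 y vs] by simp

lemma multilinear_scale:
  assumes "multilinear scale F" shows "F (us @ scale c y # vs) = scale c (F (us @ y # vs))"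
  using multilinearD[OF assms, of us 0 c y vs] multilinear_zero[OF assms] by simp

lemma multilinear_signed:
  assumes "multilinear scale F" shows "F (us @ signed k y # vs) = signed k (F (us @ y # vs))"
  using multilinear_scale[OF assms, of us "(-1)^k" y vs] by (simp add: scale_sign)

lemma multilinear_diff:
  assumes "multilinear scale F" shows "F (us @ (x - y) # vs) = F (us @ x # vs) - F (us @ y # vs)"
  using multilinearD[OF assms, of us x "-1" y vs] by simp

lemmas multilinear_hd =
  multilinear_zero[where us = "[]", simplified] multilinear_add[where us = "[]", simplified]
  multilinear_signed[where us = "[]", simplified] multilinear_diff[where us = "[]", simplified]
  multilinear_scale[where us = "[]", simplified]

lemma insertion_scale: "insertion d \<alpha> (\<lambda>xs. scale c (\<phi> xs)) xs = scale c (insertion d \<alpha> \<phi> xs)"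
  by (induction xs arbitrary: \<phi>) (simp_all add: scale_right_distrib scale_signed)

lemma insertion_linear_inner:
  assumes "multilinear scale \<phi>"
  shows "insertion d (\<lambda>xs. \<alpha> xs + scale c (\<beta> xs)) \<phi> xs = insertion d \<alpha> \<phi> xs + scale c (insertion d \<beta> \<phi> xs)"
  using assms
proof (induction xs arbitrary: \<phi>)
  case (Cons x xs)
  show ?case
    using multilinearD[OF Cons.prems, where us = "[]"] Cons.IH[OF multilinear_Cons[OF Cons.prems]]
    by (simp add: signed_add scale_right_distrib scale_signed algebra_simps)
qed simp

text \<open>
  Two insertions into disjoint segments commute up to sign and therefore cancel in the graded commutator of
  the operators \<open>\<phi> \<mapsto> \<phi> \<circ> \<alpha>\<close> and \<open>\<phi> \<mapsto> \<phi> \<circ> \<beta>\<close>. What is left are the nested insertions, where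
  \<open>\<beta>\<close> acts inside the segment of \<open>\<alpha>\<close> or conversely; these amount to inserting \<open>\<alpha> \<circ> \<beta>\<close> and
  \<open>\<beta> \<circ> \<alpha>\<close> into \<open>\<phi>\<close>. In the induction, only pairs with at least one insertion at the front need an
  argument, because the others are covered by the hypothesis for \<open>\<lambda>ys. \<phi> (x # ys)\<close>.
\<close>

lemma insertion_commutator:
  assumes "multilinear scale \<phi>" and "arity (Suc a) \<alpha>" and "arity (Suc b) \<beta>"
  shows "insertion b \<beta> (insertion a \<alpha> \<phi>) xs =
    signed (a * b) (insertion a \<alpha> (insertion b \<beta> \<phi>) xs)
    + insertion (a + b) (\<lambda>zs. insertion b \<beta> \<alpha> zs - signed (a * b) (insertion a \<alpha> \<beta> zs)) \<phi> xs"
  using assms(1)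
proof (induction xs arbitrary: \<phi>)
  case (Cons x xs)
  note ml = multilinear_hd[OF Cons.prems]
  \<comment> \<open>After an insertion of \<open>\<delta>\<close> at the front, \<open>\<gamma>\<close> acts either inside the segment of \<open>\<delta>\<close> or behind it.\<close>
  have leibniz: "insertion d \<gamma> (\<lambda>ys. \<phi> (\<delta> (x # take e ys) # drop e ys)) xs =
      \<phi> (insertion d \<gamma> (\<lambda>us. \<delta> (x # us)) (take (e + d) xs) # drop (e + d) xs)
      + signed (e * d) (insertion d \<gamma> (\<lambda>vs. \<phi> (\<delta> (x # take e xs) # vs)) (drop e xs))"
    if "arity (Suc e) \<delta>" for d e \<gamma> \<delta>
  proof -
    have push: "insertion d \<gamma> (\<lambda>us. \<phi> (f us # vs)) us = \<phi> (insertion d \<gamma> f us # vs)" for f us vs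
      by (induction us arbitrary: f) (simp_all add: ml)
    show ?thesis
      using insertion_split[of e "\<lambda>us vs. \<phi> (\<delta> (x # us) # vs)" d \<gamma> xs] arityD[OF that]
      by (simp add: push ml)
  qed
  \<comment> \<open>The five terms: \<open>\<gamma>\<close> in front and nested in \<open>\<delta>\<close>; \<open>\<gamma>\<close> in front and \<open>\<delta>\<close> behind it; \<open>\<delta>\<close> in front with
    \<open>\<gamma>\<close> nested in a later place; \<open>\<delta>\<close> in front and \<open>\<gamma>\<close> behind it; neither in front.\<close>
  have expand: "insertion d \<gamma> (insertion e \<delta> \<phi>) (x # xs) =
      \<phi> (\<delta> (\<gamma> (x # take d xs) # take e (drop d xs)) # drop (e + d) xs)
      + signed e (insertion e \<delta> (\<lambda>ys. \<phi> (\<gamma> (x # take d xs) # ys)) (drop d xs))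
      + signed d (\<phi> (insertion d \<gamma> (\<lambda>us. \<delta> (x # us)) (take (e + d) xs) # drop (e + d) xs))
      + signed (d + e * d) (insertion d \<gamma> (\<lambda>vs. \<phi> (\<delta> (x # take e xs) # vs)) (drop e xs))
      + signed (d + e) (insertion d \<gamma> (insertion e \<delta> (\<lambda>ys. \<phi> (x # ys))) xs)"
    if "arity (Suc e) \<delta>" for d e \<gamma> \<delta>
    by (simp add: insertion_add insertion_signed leibniz[OF that] signed_add signed_signed algebra_simps)
  \<comment> \<open>The first and the third term combine to \<open>\<delta> \<circ> \<gamma>\<close> inserted at the front.\<close>
  have outer: "insertion d \<gamma> \<delta> (x # take (e + d) xs) =
      \<delta> (\<gamma> (x # take d xs) # take e (drop d xs))
      + signed d (insertion d \<gamma> (\<lambda>us. \<delta> (x # us)) (take (e + d) xs))"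
      for d e \<gamma> and \<delta> :: "'b list \<Rightarrow> 'b"
    by (simp add: drop_take min_def)
  have swap: "b + a = a + b" "b * a = a * b"
    by simp_all
  show ?case
    unfolding expand[OF assms(2)] expand[OF assms(3)] Cons.IH[OF multilinear_Cons[OF Cons.prems]]
      insertion.simps(2)[of "a + b"] outer outer[of a \<alpha> \<beta> b, unfolded swap] ml swap
    by (cases "even a"; cases "even b"; simp add: signed_def algebra_simps)
qed simp

end

section \<open>The cup product and the pre-Lie identity\<close>

definition cup :: "nat \<Rightarrow> ('a list \<Rightarrow> 'a) \<Rightarrow> ('a list \<Rightarrow> 'a) \<Rightarrow> 'a list \<Rightarrow> 'a::ring" where
  "cup p F G xs = F (take p xs) * G (drop p xs)"

definition id_cochain :: "'a list \<Rightarrow> 'a::zero" where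
  "id_cochain xs = (case xs of [x] \<Rightarrow> x | _ \<Rightarrow> 0)"

lemma id_cochain_simps [simp]: "id_cochain [] = 0" "id_cochain [x] = x" "id_cochain (x # y # xs) = 0"
  by (simp_all add: id_cochain_def)

text \<open>
  The graded commutator of \<open>F\<close> with the identity in the cup algebra. Inserting it into
  another cochain produces the two sums in the definition of \<open>\<circledcirc>\<close> at once.
\<close>

definition ad_id :: "nat \<Rightarrow> ('a list \<Rightarrow> 'a) \<Rightarrow> 'a list \<Rightarrow> 'a::ring" where
  "ad_id p F xs = cup p F id_cochain xs - signed p (cup 1 id_cochain F xs)"

text \<open>
  The operation \<open>F \<circledcirc> G\<close>; lemma \<open>rb_circ_eq_rb_product\<close> identifies it with the explicit sums.
\<close>

definition rb_product :: "nat \<Rightarrow> nat \<Rightarrow> ('a list \<Rightarrow> 'a) \<Rightarrow> ('a list \<Rightarrow> 'a) \<Rightarrow> 'a list \<Rightarrow> 'a::ring" where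
  "rb_product p q F G xs = insertion q (ad_id q G) F xs + signed (p * q) (cup p F G xs)"

definition rb_commutator :: "nat \<Rightarrow> nat \<Rightarrow> ('a list \<Rightarrow> 'a) \<Rightarrow> ('a list \<Rightarrow> 'a) \<Rightarrow> 'a list \<Rightarrow> 'a::ring" where
  "rb_commutator p q F G xs = rb_product p q F G xs - signed (p * q) (rb_product q p G F xs)"

lemma id_cochain_eq_0: "length xs \<noteq> 1 \<Longrightarrow> id_cochain xs = 0"
  by (cases xs rule: remdups_adj.cases) auto

lemma arity_id_cochain: "arity 1 id_cochain"
  by (simp add: arity_def id_cochain_eq_0)

lemma arity_cup: "arity p F \<Longrightarrow> arity q G \<Longrightarrow> arity (p + q) (cup p F G)"
  unfolding arity_def cup_def
  by (metis (no_types, lifting) append_take_drop_id length_append mult_zero_left mult_zero_right)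

lemma arity_ad_id:
  assumes "arity p F" shows "arity (Suc p) (ad_id p F)"
  using arity_cup[OF assms arity_id_cochain] arity_cup[OF arity_id_cochain assms]
  by (auto simp: arity_def ad_id_def)

lemma cup_add_left: "cup p (\<lambda>xs. F xs + G xs) H xs = cup p F H xs + cup p G H xs"
  and cup_add_right: "cup p H (\<lambda>xs. F xs + G xs) xs = cup p H F xs + cup p H G xs"
  and cup_diff_left: "cup p (\<lambda>xs. F xs - G xs) H xs = cup p F H xs - cup p G H xs"
  and cup_diff_right: "cup p H (\<lambda>xs. F xs - G xs) xs = cup p H F xs - cup p H G xs"
  and cup_signed_left: "cup p (\<lambda>xs. signed k (F xs)) H xs = signed k (cup p F H xs)"
  and cup_signed_right: "cup p H (\<lambda>xs. signed k (F xs)) xs = signed k (cup p H F xs)"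
  by (simp_all add: cup_def algebra_simps signed_def)

lemmas cup_linear = cup_add_left cup_add_right cup_diff_left cup_diff_right
  cup_signed_left cup_signed_right

lemma cup_assoc: "cup (p + q) (cup p F G) H xs = cup p F (cup q G H) xs"
  by (simp add: cup_def drop_take min_def mult.assoc add.commute)

lemma insertion_cup:
  assumes "arity p F"
  shows "insertion d \<alpha> (cup p F G) xs =
    cup (p + d) (insertion d \<alpha> F) G xs + signed (p * d) (cup p F (insertion d \<alpha> G) xs)"
  using insertion_split[of p "\<lambda>us vs. F us * G vs" d \<alpha> xs] arityD[OF assms]
  by (simp add: cup_def[abs_def] insertion_mult_left insertion_mult_right)

text \<open>
  The identity cochain is mapped to \<open>\<alpha>\<close> itself, so a derivation of the form \<open>\<phi> \<mapsto> \<phi> \<circ> \<alpha>\<close> remembers \<open>\<alpha>\<close>.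
\<close>

lemma insertion_id_cochain:
  assumes "arity (Suc d) \<alpha>" shows "insertion d \<alpha> id_cochain xs = \<alpha> xs"
proof (cases xs)
  case (Cons x ys)
  have "insertion d \<alpha> (\<lambda>ys. id_cochain (x # ys)) ys = 0"
    by (rule insertion_eq_0) simp
  moreover have "id_cochain (\<alpha> (x # take d ys) # drop d ys) = \<alpha> (x # ys)"
  proof (cases "length ys = d")
    case False
    then show ?thesis
      using arityD[OF assms]
      by (cases "length ys < d") (auto simp: id_cochain_eq_0)
  qed simp
  ultimately show ?thesis
    using Cons by simp
qed (simp add: arityD[OF assms])

lemma insertion_ad_id:
  assumes "arity p F" and "arity (Suc d) \<alpha>"
  shows "insertion d \<alpha> (ad_id p F) xs =
    cup (p + d) (insertion d \<alpha> F) id_cochain xs + signed (p * d) (cup p F \<alpha> xs)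
    - signed p (cup (Suc d) \<alpha> F xs) - signed (p + d) (cup 1 id_cochain (insertion d \<alpha> F) xs)"
proof -
  have \<alpha>: "insertion d \<alpha> id_cochain = \<alpha>"
    using insertion_id_cochain[OF assms(2)] by blast
  show ?thesis
    unfolding ad_id_def insertion_diff insertion_signed insertion_cup[OF assms(1)] insertion_cup[OF arity_id_cochain] \<alpha>
    by (simp add: signed_add signed_signed)
qed

text \<open>
  \<open>F \<mapsto> \<delta>F\<close> takes the bracket to the Gerstenhaber commutator. By the Leibniz rule,
  \<open>\<delta>F \<circ> \<delta>G = \<delta>(F \<circ> \<delta>G)\<close> plus the terms in which \<open>\<delta>G\<close> replaces the identity in \<open>\<delta>F\<close>. In the graded
  commutator the words \<open>F \<smile> id \<smile> G\<close> and \<open>G \<smile> id \<smile> F\<close> of these extra terms cancel, and the others form \<open>\<delta>\<close> of the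
  graded cup commutator of \<open>F\<close> and \<open>G\<close>.
\<close>

lemma ad_id_rb_commutator:
  assumes F: "arity p F" and G: "arity q G"
  shows "ad_id (p + q) (rb_commutator p q F G) xs =
    insertion q (ad_id q G) (ad_id p F) xs - signed (p * q) (insertion p (ad_id p F) (ad_id q G) xs)"
proof -
  have assoc: "cup (m + n) (cup m K L) M = cup m K (cup n L M)"
    for m n and K L M :: "'a list \<Rightarrow> 'a"
    by (simp add: cup_assoc fun_eq_iff)
  have swap: "q + p = p + q" "q * p = p * q"
    by simp_all
  have left: "cup (Suc m) (ad_id m K) L xs = cup m K (cup 1 id_cochain L) xs - signed m (cup 1 id_cochain (cup m K L) xs)"
    for m and K L :: "'a list \<Rightarrow> 'a"
    using assoc[of m 1 K id_cochain L] assoc[of 1 m id_cochain K L]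
    by (simp add: ad_id_def[abs_def] cup_linear)
  have right: "cup m K (ad_id n L) xs = cup m K (cup n L id_cochain) xs - signed n (cup m K (cup 1 id_cochain L) xs)"
    for m n and K L :: "'a list \<Rightarrow> 'a"
    by (simp add: ad_id_def[abs_def] cup_linear)
  show ?thesis
    unfolding insertion_ad_id[OF F arity_ad_id[OF G]] insertion_ad_id[OF G arity_ad_id[OF F]]
      left right ad_id_def[of "p + q"] rb_commutator_def[abs_def] rb_product_def[abs_def] cup_linear swap
      assoc[of p q] assoc[of q p, unfolded swap]
    by (cases "even p"; cases "even q"; simp add: signed_def)
qed

context assoc_algebra
begin

text \<open>
  Right multiplication by \<open>F\<close> is the derivation \<open>X \<mapsto> X \<circ> \<delta>F\<close> plus a right cup multiplication. In the
  graded commutator of two right multiplications, the derivations contribute \<open>X \<circ> \<delta>[F, G]\<close>, and the mixed and pure cup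
  terms combine to \<open>X \<smile> [F, G]\<close>. This is the symmetry of the associator that makes \<open>\<circledcirc>\<close> a pre-Lie
  product.
\<close>

lemma rb_product_pre_Lie:
  assumes X: "multilinear scale X" "arity n X" and F: "arity p F" and G: "arity q G"
  shows "rb_product (n + p) q (rb_product n p X F) G xs =
    signed (p * q) (rb_product (n + q) p (rb_product n q X G) F xs) + rb_product n (p + q) X (rb_commutator p q F G) xs"
proof -
  have assocs: "cup (n + p) (cup n X F) G xs = cup n X (cup p F G) xs"
      "cup (n + q) (cup n X G) F xs = cup n X (cup q G F) xs"
    by (rule cup_assoc)+
  have cob: "ad_id (p + q) (rb_commutator p q F G) = (\<lambda>xs. insertion q (ad_id q G) (ad_id p F) xs
      - signed (p * q) (insertion p (ad_id p F) (ad_id q G) xs))"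
    using ad_id_rb_commutator[OF F G] by blast
  note D = insertion_commutator[OF X(1) arity_ad_id[OF F] arity_ad_id[OF G], of xs, folded cob]
  have cup_commutator: "cup n X (rb_commutator p q F G) xs =
      cup n X (insertion q (ad_id q G) F) xs + signed (p * q) (cup n X (cup p F G) xs)
      - signed (p * q) (cup n X (insertion p (ad_id p F) G) xs + signed (q * p) (cup n X (cup q G F) xs))"
    by (simp add: rb_commutator_def[abs_def] rb_product_def[abs_def] cup_linear)
  have swap: "q * p = p * q" "p * n = n * p" "q * n = n * q"
    by simp_all
  show ?thesis
    unfolding rb_product_def[abs_def] insertion_add insertion_signed insertion_cup[OF X(2)] cup_add_left
      cup_signed_left assocs D cup_commutator
      add_mult_distrib add_mult_distrib2 swap
    by (cases "even p"; cases "even q"; cases "even n"; simp add: signed_def)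
qed

end

section \<open>Multilinear maps and the Jacobi identity\<close>

context vector_space
begin

lemma multilinear_diff_signed:
  assumes "multilinear scale F" and "multilinear scale G"
  shows "multilinear scale (\<lambda>xs. F xs - signed k (G xs))"
  unfolding multilinear_def
  by (simp add: multilinearD[OF assms(1)] multilinearD[OF assms(2)] signed_add
      scale_right_diff_distrib scale_signed algebra_simps)

lemma multilinear_add_signed:
  assumes "multilinear scale F" and "multilinear scale G"
  shows "multilinear scale (\<lambda>xs. F xs + signed k (G xs))"
  unfolding multilinear_def
  by (simp add: multilinearD[OF assms(1)] multilinearD[OF assms(2)] signed_add
      scale_right_distrib scale_signed algebra_simps)

lemma multilinear_id_cochain: "multilinear scale id_cochain"
proof -
  have "id_cochain (us @ x # vs) = (if us = [] \<and> vs = [] then x else 0)" for us vs and x :: 'b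
    by (auto simp: id_cochain_eq_0 neq_Nil_conv)
  then show ?thesis
    by (auto simp: multilinear_def)
qed

lemma multilinear_insertion:
  assumes "multilinear scale \<phi>" and "multilinear scale \<alpha>"
  shows "multilinear scale (insertion d \<alpha> \<phi>)"
  unfolding multilinear_def
proof (intro allI)
  fix us vs x y c
  show "insertion d \<alpha> \<phi> (us @ (x + scale c y) # vs) =
      insertion d \<alpha> \<phi> (us @ x # vs) + scale c (insertion d \<alpha> \<phi> (us @ y # vs))"
    using assms(1)
  proof (induction us arbitrary: \<phi>)
    case Nil
    note \<phi> = multilinearD[OF Nil, where us = "[]", simplified]
    show ?case
      using multilinearD[OF assms(2), where us = "[]"]
      by (simp add: \<phi> insertion_add insertion_scale signed_add scale_right_distrib scale_signed algebra_simps)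
  next
    case (Cons u us)
    note \<phi> = multilinearD[OF Cons.prems, where us = "[]", simplified]
    note IH = Cons.IH[OF multilinear_Cons[OF Cons.prems], of u]
    show ?case
    proof (cases "length us < d")
      case True
      then obtain k where k: "d - length us = Suc k"
        by (metis Suc_diff_Suc)
      show ?thesis
        using True IH multilinearD[OF assms(2), where us = "u # us"]
        by (simp add: k \<phi> signed_add scale_right_distrib scale_signed algebra_simps)
    next
      case False
      then show ?thesis
        using IH multilinearD[OF Cons.prems, where us = "\<alpha> (u # take d us) # drop d us"]
        by (simp add: signed_add scale_right_distrib scale_signed algebra_simps)
    qed
  qed
qed

lemma arity_insertion:
  assumes "multilinear scale \<phi>" and "arity n \<phi>" and "arity (Suc d) \<alpha>"
  shows "arity (n + d) (insertion d \<alpha> \<phi>)"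
proof -
  have "insertion d \<alpha> \<phi> xs = 0" if "length xs \<noteq> n + d" for xs
    using that assms(1,2)
  proof (induction xs arbitrary: n \<phi>)
    case (Cons x xs)
    have hd: "\<phi> (\<alpha> (x # take d xs) # drop d xs) = 0"
    proof (cases "length xs < d")
      case True
      then show ?thesis
        using multilinear_hd(1)[OF Cons.prems(2)] arityD[OF assms(3)] by simp
    next
      case False
      then show ?thesis
        using Cons.prems(1) by (intro arityD[OF Cons.prems(3)]) simp
    qed
    have "insertion d \<alpha> (\<lambda>ys. \<phi> (x # ys)) xs = 0"
    proof (cases n)
      case 0
      then show ?thesis
        using Cons.prems(3) by (intro insertion_eq_0) (simp add: arity_def)
    next
      case (Suc m)
      then show ?thesis
        using Cons.prems by (intro Cons.IH[of m] multilinear_Cons) (auto simp: arity_def)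
    qed
    with hd show ?case
      by simp
  qed simp
  then show ?thesis
    by (simp add: arity_def)
qed

end

context assoc_algebra
begin

text \<open>
  For a list of the wrong length both sides of the linearity condition vanish, so the restriction
  on lengths in \<open>Hom\<close> can be dropped.
\<close>

lemma Hom_iff: "F \<in> Hom scale n \<longleftrightarrow> multilinear scale F \<and> arity n F"
proof
  assume F: "F \<in> Hom scale n"
  have "F (us @ (x + scale c y) # vs) = F (us @ x # vs) + scale c (F (us @ y # vs))" for us vs x y c
  proof (cases "length us + 1 + length vs = n")
    case True
    then have "Vector_Spaces.linear scale scale (\<lambda>x. F (us @ [x] @ vs))"
      using F by (simp add: Hom_def)
    then show ?thesis
      by (simp add: Vector_Spaces.linear_iff)
  next
    case False
    then show ?thesis
      using F by (simp add: Hom_def)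
  qed
  then show "multilinear scale F \<and> arity n F"
    using F by (auto simp: Hom_def multilinear_def arity_def)
next
  assume "multilinear scale F \<and> arity n F"
  then show "F \<in> Hom scale n"
    by (auto simp: Hom_def arity_def Vector_Spaces.linear_iff vector_space_axioms multilinear_add multilinear_scale)
qed

lemma multilinear_cup:
  assumes "multilinear scale F" and "multilinear scale G"
  shows "multilinear scale (cup p F G)"
  unfolding multilinear_def
proof (intro allI)
  fix us vs x y c
  show "cup p F G (us @ (x + scale c y) # vs) = cup p F G (us @ x # vs) + scale c (cup p F G (us @ y # vs))"
  proof (cases "length us < p")
    case True
    then obtain k where k: "p - length us = Suc k"
      by (metis Suc_diff_Suc)
    show ?thesis
      using True
      by (simp add: k cup_def multilinearD[OF assms(1)] distrib_right mult_scale_left)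
  next
    case False
    then show ?thesis
      by (simp add: cup_def multilinearD[OF assms(2)] distrib_left mult_scale_right)
  qed
qed

lemma Hom_rb_product:
  assumes "F \<in> Hom scale p" and "G \<in> Hom scale q"
  shows "rb_product p q F G \<in> Hom scale (p + q)"
proof -
  have F: "multilinear scale F" "arity p F" and G: "multilinear scale G" "arity q G"
    using assms by (simp_all add: Hom_iff)
  have \<delta>: "multilinear scale (ad_id q G)"
    unfolding ad_id_def[abs_def]
    by (intro multilinear_diff_signed multilinear_cup multilinear_id_cochain G)
  have "multilinear scale (rb_product p q F G)"
    unfolding rb_product_def[abs_def]
    by (intro multilinear_add_signed multilinear_insertion multilinear_cup F G \<delta>)
  moreover have "arity (p + q) (rb_product p q F G)"
    using arity_insertion[OF F arity_ad_id[OF G(2)]] arity_cup[OF F(2) G(2)]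
    by (simp add: arity_def rb_product_def)
  ultimately show ?thesis
    by (simp add: Hom_iff)
qed

lemma Hom_rb_commutator:
  assumes "F \<in> Hom scale p" and "G \<in> Hom scale q"
  shows "rb_commutator p q F G \<in> Hom scale (p + q)"
  using Hom_rb_product[OF assms] Hom_rb_product[OF assms(2,1)]
  unfolding Hom_iff rb_commutator_def[abs_def]
  by (auto intro: multilinear_diff_signed simp: arity_def)

lemma rb_product_linear_left:
  "rb_product p q (\<lambda>xs. F xs + scale c (F' xs)) G xs = rb_product p q F G xs + scale c (rb_product p q F' G xs)"
  by (simp add: rb_product_def insertion_add insertion_scale cup_def signed_add scale_signed
      mult_scale_left algebra_simps)

lemma ad_id_linear:
  "ad_id q (\<lambda>xs. G xs + scale c (G' xs)) xs = ad_id q G xs + scale c (ad_id q G' xs)"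
  by (simp add: ad_id_def cup_def signed_add scale_signed mult_scale_left mult_scale_right
       algebra_simps)

lemma rb_product_linear_right:
  assumes "multilinear scale F"
  shows "rb_product p q F (\<lambda>xs. G xs + scale c (G' xs)) xs =
    rb_product p q F G xs + scale c (rb_product p q F G' xs)"
  by (simp add: rb_product_def ad_id_linear[abs_def] insertion_linear_inner[OF assms] cup_def signed_add scale_signed
      mult_scale_right algebra_simps)

lemma rb_product_rb_commutator_left:
  fixes F G H :: "'a list \<Rightarrow> 'a"
  shows "rb_product n r (rb_commutator p q F G) H xs =
    rb_product n r (rb_product p q F G) H xs - signed (p * q) (rb_product n r (rb_product q p G F) H xs)"
  using rb_product_linear_left[of n r "rb_product p q F G" "- ((- 1) ^ (p * q))" "rb_product q p G F" H xs]
  by (simp add: rb_commutator_def[abs_def] scale_sign)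

lemma rb_commutator_antisym: "rb_commutator p q F G xs = - signed (p * q) (rb_commutator q p G F xs)"
  by (simp add: rb_commutator_def signed_def mult.commute)

text \<open>
  All twelve products in the Jacobi identity are of the form \<open>X \<circledcirc> (Y \<circledcirc> Z)\<close> or \<open>(X \<circledcirc> Y) \<circledcirc> Z\<close>.
  Three instances of the pre-Lie identity, one for each choice of \<open>X\<close>, relate them.
\<close>

lemma rb_commutator_Jacobi:
  assumes F: "F \<in> Hom scale p" and G: "G \<in> Hom scale q" and H: "H \<in> Hom scale r"
  shows "rb_commutator p (q + r) F (rb_commutator q r G H) xs =
    rb_commutator (p + q) r (rb_commutator p q F G) H xs
    + signed (p * q) (rb_commutator q (p + r) G (rb_commutator p r F H) xs)"
proof -
  note hom = assms[unfolded Hom_iff]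
  have eqs: "rb_product (p + q) r (rb_product p q F G) H xs =
      signed (q * r) (rb_product (p + r) q (rb_product p r F H) G xs) + rb_product p (q + r) F (rb_commutator q r G H) xs"
    "rb_product (p + q) r (rb_product q p G F) H xs =
      signed (p * r) (rb_product (q + r) p (rb_product q r G H) F xs) + rb_product q (p + r) G (rb_commutator p r F H) xs"
    "rb_product (p + r) q (rb_product r p H F) G xs =
      signed (p * q) (rb_product (q + r) p (rb_product r q H G) F xs) + rb_product r (p + q) H (rb_commutator p q F G) xs"
    using rb_product_pre_Lie[of F p q G r H xs] rb_product_pre_Lie[of G q p F r H xs]
      rb_product_pre_Lie[of H r p F q G xs] hom
    by (simp_all add: add.commute)
  have swap: "q * p = p * q" "r * p = p * r" "r * q = q * r"
    by simp_all
  show ?thesis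
    unfolding rb_commutator_def[of p "q + r"] rb_commutator_def[of "p + q" r] rb_commutator_def[of q "p + r"]
      rb_product_rb_commutator_left eqs add_mult_distrib add_mult_distrib2 swap
    using eqs(3)
    by (cases "even p"; cases "even q"; cases "even r"; simp add: signed_def)
qed

section \<open>Comparison with the explicit sums\<close>

text \<open>
  For \<open>i \<ge> p\<close> the segment starting at position \<open>i\<close> is too short, so that only the \<open>p\<close> summands of the
  defining formula remain in the insertion of \<open>\<delta>G\<close>.
\<close>

lemma rb_circ_eq_rb_product:
  assumes F: "F \<in> Hom scale p" and G: "G \<in> Hom scale q" and len: "length xs = p + q"
  shows "rb_circ scale p q F G xs = rb_product p q F G xs"
proof -
  note ml = F[unfolded Hom_iff, THEN conjunct1]
  define t where "t i = F (take i xs @ ad_id q G (take (Suc q) (drop i xs)) # drop (Suc (i + q)) xs)" for i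
  have vanish: "t i = 0" if "\<not> i < p" for i
  proof -
    have "ad_id q G (take (Suc q) (drop i xs)) = 0"
      using that len by (intro arityD[OF arity_ad_id]) (use G in \<open>auto simp: Hom_iff\<close>)
    then show ?thesis
      by (simp add: t_def multilinear_zero[OF ml])
  qed
  have expand: "signed (i * q) (t i) =
      signed (i * q) (F (take i xs @ (G (take q (drop i xs)) * xs ! (i + q)) # drop (Suc (i + q)) xs))
      - signed (Suc i * q) (F (take i xs @ (xs ! i * G (take q (drop (Suc i) xs))) # drop (Suc (i + q)) xs))"
    if "i < p" for i
  proof -
    have "take (Suc q) (drop i xs) = xs ! i # take q (drop (Suc i) xs)"
      using that len by (simp add: Cons_nth_drop_Suc[symmetric])
    then have "cup 1 id_cochain G (take (Suc q) (drop i xs)) = xs ! i * G (take q (drop (Suc i) xs))"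
      by (simp add: cup_def)
    moreover have "drop q (take (Suc q) (drop i xs)) = [xs ! (i + q)]"
      using that len Cons_nth_drop_Suc[of "i + q" xs, symmetric]
      by (simp add: drop_take add.commute[of q])
    then have "cup q G id_cochain (take (Suc q) (drop i xs)) = G (take q (drop i xs)) * xs ! (i + q)"
      by (simp add: cup_def min_def)
    ultimately have "ad_id q G (take (Suc q) (drop i xs)) =
        G (take q (drop i xs)) * xs ! (i + q) - signed q (xs ! i * G (take q (drop (Suc i) xs)))"
      by (simp add: ad_id_def)
    then show ?thesis
      by (simp add: t_def multilinear_diff[OF ml] multilinear_signed[OF ml] signed_diff signed_signed
          add.commute)
  qed
  have "insertion q (ad_id q G) F xs = (\<Sum>i<p + q. signed (i * q) (t i))"
    by (simp add: insertion_sum len t_def)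
  also have "\<dots> = (\<Sum>i<p. signed (i * q) (t i))"
    by (intro sum.mono_neutral_right) (auto simp: vanish)
  also have "\<dots> =
      (\<Sum>i<p. signed (i * q) (F (take i xs @ (G (take q (drop i xs)) * xs ! (i + q)) # drop (Suc (i + q)) xs)))
      - (\<Sum>i<p. signed (Suc i * q) (F (take i xs @ (xs ! i * G (take q (drop (Suc i) xs))) # drop (Suc (i + q)) xs)))"
    by (simp add: expand sum_subtractf)
  finally show ?thesis
    by (simp add: rb_circ_def rb_product_def cup_def scale_sign sum.atLeast1_atMost_eq)
qed

text \<open>
  The bracket with an element \<open>a\<close> is not a separate case: for \<open>q = 0\<close> the two sums of \<open>\<circledcirc>\<close> are the insertions of
  \<open>a x\<^sub>i\<close> and \<open>x\<^sub>i a\<close>, the cup term is \<open>F(x\<^sub>1, \<dots>, x\<^sub>p) a\<close>, and \<open>a \<circledcirc> F\<close> is \<open>a F(x\<^sub>1, \<dots>, x\<^sub>p)\<close>.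
\<close>

lemma rb_bracket_hom_eq_rb_commutator:
  assumes F: "F \<in> Hom scale p" and G: "G \<in> Hom scale q"
  shows "rb_bracket_hom scale p q F G = rb_commutator p q F G"
proof
  fix xs
  show "rb_bracket_hom scale p q F G xs = rb_commutator p q F G xs"
  proof (cases "length xs = p + q")
    case False
    then show ?thesis
      using Hom_rb_commutator[OF assms] by (simp add: rb_bracket_hom_def Hom_iff arity_def)
  next
    case True
    have act: "rb_act n H (K []) ys = rb_circ scale n 0 H K ys - rb_circ scale 0 n K H ys"
      if "H \<in> Hom scale n" "length ys = n" for n H K ys
      using multilinear_diff[of H] that
      by (simp add: rb_act_def rb_circ_def Hom_iff sum_subtractf)
    have "rb_bracket_hom scale p q F G xs =
        rb_circ scale p q F G xs - scale ((- 1) ^ (p * q)) (rb_circ scale q p G F xs)"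
      using True act[OF F, of xs G] act[OF G, of xs F] by (auto simp: rb_bracket_hom_def rb_circ_def)
    then show ?thesis
      using True rb_circ_eq_rb_product[OF F G] rb_circ_eq_rb_product[OF G F]
      by (simp add: rb_commutator_def scale_sign add.commute)
  qed
qed

end

section \<open>The graded Lie algebra of multilinear maps\<close>

lemma fscale_apply: "fscale scale c F xs = scale c (F xs)"
  by (simp add: fscale_def)

context assoc_algebra
begin

lemma vector_space_fscale: "vector_space (fscale scale)"
  by unfold_locales
    (auto simp: fscale_def fun_eq_iff scale_right_distrib scale_left_distrib)

interpretation maps: vector_space "fscale scale"
  by (rule vector_space_fscale)

lemma subspace_Hom: "maps.subspace (Hom scale n)"
proof (rule maps.subspaceI)
  show "0 \<in> Hom scale n"
    by (simp add: Hom_iff multilinear_def arity_def)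
next
  fix F G
  assume "F \<in> Hom scale n" "G \<in> Hom scale n"
  then have F: "multilinear scale F" "arity n F" and G: "multilinear scale G" "arity n G"
    by (simp_all add: Hom_iff)
  show "F + G \<in> Hom scale n"
    using F(2) G(2) multilinear_add_signed[OF F(1) G(1), of 0]
    by (simp add: Hom_iff arity_def signed_def plus_fun_def)
next
  fix c F
  assume "F \<in> Hom scale n"
  then have F: "multilinear scale F" "arity n F"
    by (simp_all add: Hom_iff)
  have "multilinear scale (fscale scale c F)"
    unfolding multilinear_def fscale_def
    by (simp add: multilinearD[OF F(1)] scale_right_distrib mult.commute)
  then show "fscale scale c F \<in> Hom scale n"
    using F(2) by (simp add: Hom_iff arity_def fscale_def)
qed

text \<open>
  Bilinearity of the bracket is required on the whole direct sum. There it reduces to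
  homogeneous arguments, because the components of an element of the span are multilinear.
\<close>

lemma component_span_Hom:
  assumes "F \<in> maps.span (\<Union>n. Hom scale n)"
  shows "component n F \<in> Hom scale n"
  using assms
proof (induction rule: maps.span_induct_alt)
  case base
  have "component n (0 :: 'a list \<Rightarrow> 'a) = 0"
    by (rule ext) (simp add: component_def)
  then show ?case
    by (simp only: maps.subspace_0[OF subspace_Hom])
next
  case (step c F G)
  then obtain m where m: "F \<in> Hom scale m"
    by blast
  have "component n F = (if n = m then F else 0)"
    using component_Hom[OF m, of n] by (simp only: zero_fun_def)
  then have F: "component n F \<in> Hom scale n"
    using maps.subspace_0[OF subspace_Hom] m by simp
  have "component n (fscale scale c F + G) = fscale scale c (component n F) + component n G"
    by (rule ext) (simp add: component_def fscale_def)
  then show ?case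
    using step.IH F by (simp only: maps.subspace_add maps.subspace_scale subspace_Hom)
qed

lemma Hom_direct:
  assumes "finite N" and "\<And>n. n \<in> N \<Longrightarrow> c n \<in> Hom scale n" and "(\<Sum>n\<in>N. c n) = 0" and "m \<in> N"
  shows "c m = 0"
proof
  fix xs :: "'a list"
  have sum: "(\<Sum>n\<in>N'. c n) xs = (\<Sum>n\<in>N'. c n xs)" for N'
    by (induction N' rule: infinite_finite_induct) simp_all
  show "c m xs = 0 xs"
  proof (cases "length xs = m")
    case True
    have "(\<Sum>n\<in>N. c n xs) = (\<Sum>n\<in>N. if n = m then c m xs else 0)"
      using assms(2) True by (intro sum.cong) (auto simp: Hom_iff arity_def)
    also have "\<dots> = c m xs"
      using assms(1,4) by simp
    finally have "(\<Sum>n\<in>N. c n xs) = c m xs" .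
    then show ?thesis
      using sum[of N] assms(3) by simp
  next
    case False
    then show ?thesis
      using assms(2)[OF assms(4)] by (simp add: Hom_iff arity_def)
  qed
qed

lemma rb_bracket_span:
  assumes "F \<in> maps.span (\<Union>n. Hom scale n)" and "G \<in> maps.span (\<Union>n. Hom scale n)"
  shows "rb_bracket scale F G xs =
    (\<Sum>p\<le>length xs. rb_commutator p (length xs - p) (component p F) (component (length xs - p) G) xs)"
  using assms by (simp add: rb_bracket_def Let_def rb_bracket_hom_eq_rb_commutator component_span_Hom)

lemma rb_commutator_linear_left:
  assumes "multilinear scale G"
  shows "rb_commutator p q (\<lambda>xs. F xs + scale c (F' xs)) G xs =
    rb_commutator p q F G xs + scale c (rb_commutator p q F' G xs)"
  by (simp add: rb_commutator_def rb_product_linear_left rb_product_linear_right[OF assms] signed_add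
      scale_signed scale_right_diff_distrib)

lemma rb_commutator_linear_right:
  assumes "multilinear scale F"
  shows "rb_commutator p q F (\<lambda>xs. G xs + scale c (G' xs)) xs =
    rb_commutator p q F G xs + scale c (rb_commutator p q F G' xs)"
  by (simp add: rb_commutator_def rb_product_linear_left rb_product_linear_right[OF assms] signed_add
      scale_signed scale_right_diff_distrib)

lemma component_linear_combination:
  "component n (F + fscale scale c F') = (\<lambda>xs. component n F xs + scale c (component n F' xs))"
  by (auto simp: component_def fscale_def)

lemma rb_bracket_linear_left:
  assumes "F \<in> maps.span (\<Union>n. Hom scale n)" and "F' \<in> maps.span (\<Union>n. Hom scale n)"
    and "G \<in> maps.span (\<Union>n. Hom scale n)"
  shows "rb_bracket scale (F + fscale scale c F') G =
    rb_bracket scale F G + fscale scale c (rb_bracket scale F' G)"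
proof
  fix xs
  have ml: "multilinear scale (component n G)" for n
    using component_span_Hom[OF assms(3)] by (simp add: Hom_iff)
  show "rb_bracket scale (F + fscale scale c F') G xs =
      (rb_bracket scale F G + fscale scale c (rb_bracket scale F' G)) xs"
    using assms by (simp add: rb_bracket_span maps.span_add maps.span_scale
        component_linear_combination rb_commutator_linear_left[OF ml] fscale_apply sum.distrib scale_sum_right)
qed

lemma rb_bracket_linear_right:
  assumes "F \<in> maps.span (\<Union>n. Hom scale n)" and "G \<in> maps.span (\<Union>n. Hom scale n)"
    and "G' \<in> maps.span (\<Union>n. Hom scale n)"
  shows "rb_bracket scale F (G + fscale scale c G') =
    rb_bracket scale F G + fscale scale c (rb_bracket scale F G')"
proof
  fix xs
  have ml: "multilinear scale (component n F)" for n
    using component_span_Hom[OF assms(1)] by (simp add: Hom_iff)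
  show "rb_bracket scale F (G + fscale scale c G') xs =
      (rb_bracket scale F G + fscale scale c (rb_bracket scale F G')) xs"
    using assms by (simp add: rb_bracket_span maps.span_add maps.span_scale
        component_linear_combination rb_commutator_linear_right[OF ml] fscale_apply sum.distrib scale_sum_right)
qed

lemma rb_bracket_eq_rb_commutator:
  assumes "F \<in> Hom scale p" and "G \<in> Hom scale q"
  shows "rb_bracket scale F G = rb_commutator p q F G"
  using rb_bracket_homogeneous[OF vector_space_axioms assms] rb_bracket_hom_eq_rb_commutator[OF assms]
  by simp

lemma fscale_sign: "fscale scale ((- 1) ^ k) F = (\<lambda>xs. signed k (F xs))"
  by (simp add: fscale_def scale_sign)

lemma graded_lie_algebra_Hom: "graded_lie_algebra (fscale scale) (Hom scale) (rb_bracket scale)"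
proof unfold_locales
  fix F G H
  assume "F \<in> maps.span (\<Union>n. Hom scale n)" "G \<in> maps.span (\<Union>n. Hom scale n)"
    "H \<in> maps.span (\<Union>n. Hom scale n)"
  then show "rb_bracket scale (F + G) H = rb_bracket scale F H + rb_bracket scale G H"
    and "rb_bracket scale F (G + H) = rb_bracket scale F G + rb_bracket scale F H"
    using rb_bracket_linear_left[of F G H 1] rb_bracket_linear_right[of F G H 1] by simp_all
next
  fix F G c
  assume span: "F \<in> maps.span (\<Union>n. Hom scale n)" "G \<in> maps.span (\<Union>n. Hom scale n)"
  have "rb_bracket scale 0 G = 0" and "rb_bracket scale F 0 = 0"
    using rb_bracket_linear_left[of 0 0 G 1] rb_bracket_linear_right[of F 0 0 1] span
    by (simp_all add: maps.span_zero)
  then show "rb_bracket scale (fscale scale c F) G = fscale scale c (rb_bracket scale F G)"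
    and "rb_bracket scale F (fscale scale c G) = fscale scale c (rb_bracket scale F G)"
    using rb_bracket_linear_left[of 0 F G c] rb_bracket_linear_right[of F 0 G c] span
    by (simp_all add: maps.span_zero)
next
  fix F G p q
  assume "F \<in> Hom scale p" "G \<in> Hom scale q"
  then show "rb_bracket scale F G \<in> Hom scale (p + q)"
    and "rb_bracket scale F G = - fscale scale ((- 1) ^ (p * q)) (rb_bracket scale G F)"
    using rb_commutator_antisym[of p q F G]
    by (simp_all add: rb_bracket_eq_rb_commutator Hom_rb_commutator fscale_sign fun_eq_iff)
next
  fix F G H p q r
  assume "F \<in> Hom scale p" "G \<in> Hom scale q" "H \<in> Hom scale r"
  then show "rb_bracket scale F (rb_bracket scale G H) = rb_bracket scale (rb_bracket scale F G) H
      + fscale scale ((- 1) ^ (p * q)) (rb_bracket scale G (rb_bracket scale F H))"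
    using rb_commutator_Jacobi[of F p G q H r]
    by (simp add: rb_bracket_eq_rb_commutator[of _ p _ q] rb_bracket_eq_rb_commutator[of _ p _ r]
        rb_bracket_eq_rb_commutator[of _ q _ r] rb_bracket_eq_rb_commutator[of _ p _ "q + r"]
        rb_bracket_eq_rb_commutator[of _ q _ "p + r"] rb_bracket_eq_rb_commutator[of _ "p + q" _ r]
        Hom_rb_commutator fscale_sign fun_eq_iff)
qed (use subspace_Hom Hom_direct in blast)+

end

section \<open>Cyclic cochains\<close>

text \<open>
  Rotating one of \<open>m + 1\<close> arguments past the \<open>m\<close> others has sign \<open>(-1)\<^sup>m\<close>; this is the signed norm operator of
  cyclic cohomology.
\<close>

definition cyclic_sum :: "nat \<Rightarrow> ('a list \<Rightarrow> 'b::ab_group_add) \<Rightarrow> 'a list \<Rightarrow> 'b" where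
  "cyclic_sum m T xs = (\<Sum>k<Suc m. signed (k * m) (T (rotate k xs)))"

text \<open>
  The rotation permutes the summands. A full turn has sign \<open>(-1)\<^sup>m\<^sup>(\<^sup>m\<^sup>+\<^sup>1\<^sup>) = 1\<close>, so the last summand fits in place of the first.
\<close>

lemma cyclic_sum_rotate1:
  assumes "length xs = Suc m"
  shows "cyclic_sum m T (rotate1 xs) = signed m (cyclic_sum m T xs)"
proof -
  have rot: "rotate k (rotate1 xs) = rotate (Suc k) xs" for k
    by (simp add: rotate1_rotate_swap)
  have full: "rotate (Suc m) xs = xs"
    using rotate_id[of "Suc m" xs] assms by simp
  have "cyclic_sum m T (rotate1 xs) =
      (\<Sum>k<m. signed (k * m) (T (rotate (Suc k) xs))) + signed (m * m) (T xs)"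
    unfolding cyclic_sum_def rot by (simp only: sum.lessThan_Suc full)
  also have "\<dots> = signed m (cyclic_sum m T xs)"
    unfolding cyclic_sum_def sum.lessThan_Suc_shift signed_add signed_sum signed_signed
    by (cases "even m") (simp_all add: signed_def)
  finally show ?thesis .
qed

lemma sum_lessThan_add: "(\<Sum>i<a + b. f i) = (\<Sum>i<a. f i) + (\<Sum>i<b. f (a + i))"
  for f :: "nat \<Rightarrow> 'b::comm_monoid_add"
  by (induction b) (simp_all add: add.assoc)

context symmetric_frobenius_algebra
begin

lemma form_add_left: "form (x + y) z = form x z + form y z"
  using form_linear_left[of z] by (simp add: Vector_Spaces.linear_iff)

lemma form_scale_left: "form (scale c x) z = c * form x z"
  using form_linear_left[of z] by (simp add: Vector_Spaces.linear_iff)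

lemma form_zero_left: "form 0 z = 0"
  using form_scale_left[of 0 0 z] by simp

lemma form_signed_left: "form (signed k x) z = signed k (form x z)"
  using form_scale_left[of "(- 1) ^ k" x z] by (simp add: scale_sign signed_def)

lemma form_diff_left: "form (x - y) z = form x z - form y z"
  using form_add_left[of x "signed 1 y" z] form_signed_left[of 1 y z] by (simp add: signed_def)

lemma form_sum_left: "form (sum f I) z = (\<Sum>i\<in>I. form (f i) z)"
  by (induction I rule: infinite_finite_induct) (simp_all add: form_add_left form_zero_left)

lemma form_rotate: "form x (y * z) = form y (z * x)"
  using form_sym[of x "y * z"] form_invariant[of y z x] by simp

text \<open>
  In terms of the \<open>k\<close>-valued cochain \<open>\<langle>F(x\<^sub>1, \<dots>, x\<^sub>p), x\<^sub>p\<^sub>+\<^sub>1\<rangle>\<close>, membership in \<open>Crb\<close> is equivariance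
  under rotation of the argument list.
\<close>

definition pairing :: "('a list \<Rightarrow> 'a) \<Rightarrow> 'a list \<Rightarrow> 'k" where
  "pairing F xs = form (F (butlast xs)) (last xs)"

lemma Crb_iff:
  "F \<in> Crb scale form p \<longleftrightarrow> F \<in> Hom scale p \<and>
    (\<forall>xs. length xs = Suc p \<longrightarrow> pairing F (rotate1 xs) = signed p (pairing F xs))"
proof -
  have "form (F (tl xs)) (hd xs) = (- 1) ^ p * form (F (butlast xs)) (last xs) \<longleftrightarrow>
      pairing F (rotate1 xs) = signed p (pairing F xs)" if "length xs = Suc p" for xs
    using that by (cases xs) (auto simp: pairing_def signed_def)
  then show ?thesis
    by (auto simp: Crb_def)
qed

lemma pairing_rotate:
  assumes "F \<in> Crb scale form p" and "length xs = Suc p"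
  shows "pairing F (rotate k xs) = signed (k * p) (pairing F xs)"
proof (induction k)
  case (Suc k)
  then show ?case
    using assms by (simp add: Crb_iff signed_signed)
qed (simp add: signed_def)

text \<open>
  The two shapes into which all summands of \<open>\<langle>[F, G](x\<^sub>1, \<dots>, x\<^sub>m), x\<^sub>0\<rangle>\<close> can be brought: the factor \<open>w\<close>
  is the single argument consumed neither by \<open>F\<close> nor by \<open>G\<close>. It follows the arguments of \<open>G\<close> in
  \<open>left_chain\<close> and precedes them in \<open>right_chain\<close>, the arguments of \<open>F\<close> coming first in both cases.
\<close>

definition left_chain where
  "left_chain p q F G zs = form (F (take p zs)) (G (take q (drop p zs)) * last zs)"

definition right_chain where
  "right_chain p F G zs = form (F (take p zs)) (zs ! p * G (drop (Suc p) zs))"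

text \<open>
  Cyclicity of \<open>F\<close> moves the inserted element \<open>z\<close> from its place among the arguments into the second slot of the form.
\<close>

lemma form_insert_Crb:
  assumes F: "F \<in> Crb scale form p" and len: "length xs = p + q" and i: "i < p"
  shows "form (F (take i xs @ z # drop (Suc (i + q)) xs)) y =
    signed (Suc i * p) (form (F (drop (Suc (i + q)) (xs @ [y]) @ take i xs)) z)"
proof -
  define A B where "A = take i xs @ [z]" and "B = drop (Suc (i + q)) xs @ [y]"
  have lens: "length A = Suc i" "length (A @ B) = Suc p"
    using len i by (auto simp: A_def B_def)
  have "rotate (Suc i) (A @ B) = B @ A"
    using rotate_append[of A B] by (simp only: lens(1))
  then have "pairing F (B @ A) = signed (Suc i * p) (pairing F (A @ B))"
    using pairing_rotate[OF F lens(2), of "Suc i"] by (simp only:)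
  then have "pairing F (A @ B) = signed (Suc i * p) (pairing F (B @ A))"
    by (simp only: signed_signed) (simp add: signed_def)
  then show ?thesis
    using len i by (simp add: pairing_def A_def B_def butlast_append)
qed

lemma rotate_parts:
  assumes "length zs = Suc (p + q)" and "i < p"
  shows "take p (rotate (Suc (i + q)) zs) = drop (Suc (i + q)) zs @ take i zs"
    and "drop p (rotate (Suc (i + q)) zs) = take (Suc q) (drop i zs)"
  using assms by (simp_all add: rotate_drop_take min_def drop_take)

text \<open>
  The summand of \<open>F \<circledcirc> G\<close> whose segment starts at position \<open>i\<close> (counted from \<open>0\<close>) becomes the chain whose
  rotation by \<open>i + q + 1\<close> puts that segment at the end of the list. The cup term is the unrotated left chain. It
  has no right counterpart, which accounts for the difference between the two shapes.
\<close>

lemma pairing_rb_circ: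
  assumes F: "F \<in> Crb scale form p" and len: "length zs = Suc (p + q)"
  shows "pairing (rb_circ scale p q F G) zs =
    signed (p * q) (left_chain p q F G zs
      + (\<Sum>i<p. signed (Suc (i + q) * (p + q)) (left_chain p q F G (rotate (Suc (i + q)) zs))))
    - signed (p * q + q) (\<Sum>i<p. signed (Suc (i + q) * (p + q)) (right_chain p F G (rotate (Suc (i + q)) zs)))"
proof -
  obtain xs y where zs: "zs = xs @ [y]" and xs: "length xs = p + q"
    using len by (cases zs rule: rev_cases) auto
  \<comment> \<open>The segment of \<open>q + 1\<close> arguments seen as \<open>w\<close> followed by the arguments of \<open>G\<close>, and the other way round.\<close>
  have segment: "take (Suc q) (drop i zs) = xs ! i # take q (drop (Suc i) xs)"
      "take (Suc q) (drop i zs) = take q (drop i xs) @ [xs ! (i + q)]" if "i < p" for i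
  proof -
    show "take (Suc q) (drop i zs) = xs ! i # take q (drop (Suc i) xs)"
      using that xs by (simp add: zs Cons_nth_drop_Suc[symmetric])
    show "take (Suc q) (drop i zs) = take q (drop i xs) @ [xs ! (i + q)]"
      using that xs by (simp add: zs take_Suc_conv_app_nth)
  qed
  have left: "signed (i * q) (form (F (take i xs @ (G (take q (drop i xs)) * xs ! (i + q)) # drop (Suc (i + q)) xs)) y) =
      signed (p * q + Suc (i + q) * (p + q)) (left_chain p q F G (rotate (Suc (i + q)) zs))" if "i < p" for i
  proof -
    let ?R = "rotate (Suc (i + q)) zs"
    have "last ?R = last (drop p ?R)"
      using len by (simp add: last_drop)
    also have "\<dots> = xs ! (i + q)"
      unfolding rotate_parts[OF len that] segment(2)[OF that] by simp
    finally have last: "last ?R = xs ! (i + q)" .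
    have "take q (drop p ?R) = take q (drop i xs)"
      unfolding rotate_parts[OF len that] segment(2)[OF that] using that xs by simp
    then have "left_chain p q F G ?R =
        form (F (drop (Suc (i + q)) (xs @ [y]) @ take i xs)) (G (take q (drop i xs)) * xs ! (i + q))"
      unfolding left_chain_def last rotate_parts(1)[OF len that] using that xs by (simp add: zs)
    then show ?thesis
      unfolding form_insert_Crb[OF F xs that] by (auto simp: signed_def)
  qed
  have right: "signed (Suc i * q) (form (F (take i xs @ (xs ! i * G (take q (drop (Suc i) xs))) # drop (Suc (i + q)) xs)) y) =
      signed (p * q + q + Suc (i + q) * (p + q)) (right_chain p F G (rotate (Suc (i + q)) zs))" if "i < p" for i
  proof -
    let ?R = "rotate (Suc (i + q)) zs"
    have "drop p ?R = ?R ! p # drop (Suc p) ?R"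
      using len by (simp add: Cons_nth_drop_Suc)
    then have "?R ! p = xs ! i" "drop (Suc p) ?R = take q (drop (Suc i) xs)"
      unfolding rotate_parts[OF len that] segment(1)[OF that] by simp_all
    then have "right_chain p F G ?R =
        form (F (drop (Suc (i + q)) (xs @ [y]) @ take i xs)) (xs ! i * G (take q (drop (Suc i) xs)))"
      unfolding right_chain_def rotate_parts(1)[OF len that] using that xs by (simp add: zs)
    then show ?thesis
      unfolding form_insert_Crb[OF F xs that] by (auto simp: signed_def)
  qed
  have last_term: "form (F (take p xs) * G (drop p xs)) y = left_chain p q F G zs"
    using xs by (simp add: zs left_chain_def form_invariant)
  show ?thesis
    by (simp add: pairing_def zs rb_circ_def scale_sign sum.atLeast1_atMost_eq
        form_add_left form_diff_left form_sum_left form_signed_left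
        last_term[unfolded zs] left[unfolded zs] right[unfolded zs]
        signed_add signed_sum signed_signed del: mult_Suc)
qed

text \<open>
  Exchanging the roles of \<open>F\<close> and \<open>G\<close> leads to the same two shapes: symmetry and invariance give
  \<open>\<langle>G, F w\<rangle> = \<langle>F, w G\<rangle>\<close> and \<open>\<langle>G, w F\<rangle> = \<langle>F, G w\<rangle>\<close>, and the rotation brings the arguments of \<open>F\<close> to the front.
\<close>

lemma left_chain_swap:
  assumes "length zs = Suc (p + q)"
  shows "left_chain q p G F zs = right_chain p F G (rotate q zs)"
proof -
  have rot: "rotate q zs = drop q zs @ take q zs"
    using assms by (simp add: rotate_drop_take)
  have "last zs = zs ! (p + q)"
    using assms by (cases zs rule: rev_cases) (auto simp: nth_append)
  then show ?thesis
    using assms unfolding left_chain_def right_chain_def rot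
    by (simp add: nth_append add.commute form_rotate[of "G (take q zs)"])
qed

lemma right_chain_swap:
  assumes "length zs = Suc (p + q)"
  shows "right_chain q G F zs = left_chain p q F G (rotate (Suc q) zs)"
proof -
  have rot: "rotate (Suc q) zs = drop (Suc q) zs @ take (Suc q) zs"
  proof (cases "p = 0")
    case True
    then show ?thesis
      using assms rotate_id[of "Suc q" zs] by simp
  qed (use assms in \<open>simp add: rotate_drop_take\<close>)
  have "last (take (Suc q) zs) = zs ! q"
    using assms by (simp add: take_Suc_conv_app_nth)
  then have last: "last (drop (Suc q) zs @ take (Suc q) zs) = zs ! q"
    using assms by (subst last_appendR) auto
  show ?thesis
    using assms unfolding left_chain_def right_chain_def rot last
    by (simp add: min_def form_rotate[of _ "G (take q zs)"])
qed

text \<open>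
  Among the rotations of the left chain, \<open>F \<circledcirc> G\<close> contributes those by \<open>0\<close> and \<open>q + 1, \<dots>, p + q\<close>, and
  \<open>G \<circledcirc> F\<close> those by \<open>1, \<dots>, q\<close>. For the right chain the ranges are \<open>q + 1, \<dots>, p + q\<close> and
  \<open>0, \<dots>, q\<close>. In both cases every rotation occurs exactly once.
\<close>

lemma pairing_rb_commutator:
  assumes F: "F \<in> Crb scale form p" and G: "G \<in> Crb scale form q" and len: "length zs = Suc (p + q)"
  shows "pairing (rb_commutator p q F G) zs =
    signed (p * q) (cyclic_sum (p + q) (left_chain p q F G) zs)
    - signed (p * q + q) (cyclic_sum (p + q) (right_chain p F G) zs)"
proof -
  let ?L = "left_chain p q F G" and ?R = "right_chain p F G"
  have hom: "F \<in> Hom scale p" "G \<in> Hom scale q"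
    using F G by (simp_all add: Crb_def)
  \<comment> \<open>The swap lemmas shift the rotation amounts of \<open>G \<circledcirc> F\<close> by \<open>q\<close> and \<open>q + 1\<close>; a full turn is then removed.\<close>
  have mod: "rotate (Suc (p + q) + i) zs = rotate i zs" for i
    using rotate_rotate[of i "Suc (p + q)" zs] rotate_id[of "Suc (p + q)" zs] len by (simp add: add.commute)
  have R: "left_chain q p G F (rotate (Suc (i + p)) zs) = ?R (rotate i zs)" for i
  proof -
    have "rotate q (rotate (Suc (i + p)) zs) = rotate (Suc (p + q) + i) zs"
      by (simp only: rotate_rotate) (simp add: ac_simps)
    then show ?thesis
      using left_chain_swap[of "rotate (Suc (i + p)) zs" p q] len by (simp only: mod) simp
  qed
  have L: "right_chain q G F (rotate (Suc (i + p)) zs) = ?L (rotate (Suc i) zs)" for i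
  proof -
    have "rotate (Suc q) (rotate (Suc (i + p)) zs) = rotate (Suc (p + q) + Suc i) zs"
      by (simp only: rotate_rotate) (simp add: ac_simps)
    then show ?thesis
      using right_chain_swap[of "rotate (Suc (i + p)) zs" p q] len by (simp only: mod) simp
  qed
  have sum_L: "cyclic_sum (p + q) ?L zs = ?L zs
      + (\<Sum>i<q. signed (Suc i * (p + q)) (?L (rotate (Suc i) zs)))
      + (\<Sum>i<p. signed (Suc (i + q) * (p + q)) (?L (rotate (Suc (i + q)) zs)))"
    unfolding cyclic_sum_def sum.lessThan_Suc_shift add.commute[of p q] sum_lessThan_add
    by (simp add: signed_def add.commute add.assoc)
  have sum_R: "cyclic_sum (p + q) ?R zs = (\<Sum>i<q. signed (i * (p + q)) (?R (rotate i zs)))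
      + signed (q * (p + q)) (?R (rotate q zs))
      + (\<Sum>i<p. signed (Suc (i + q) * (p + q)) (?R (rotate (Suc (i + q)) zs)))"
    unfolding cyclic_sum_def using sum_lessThan_add[of "\<lambda>k. signed (k * (p + q)) (?R (rotate k zs))" "Suc q" p]
    by (simp add: add.commute add.left_commute)
  have "pairing (rb_commutator p q F G) zs =
      pairing (rb_circ scale p q F G) zs - signed (p * q) (pairing (rb_circ scale q p G F) zs)"
    using len by (simp add: pairing_def rb_commutator_def form_diff_left form_signed_left
        rb_circ_eq_rb_product[OF hom] rb_circ_eq_rb_product[OF hom(2,1)])
  also have "\<dots> = signed (p * q) (cyclic_sum (p + q) ?L zs) - signed (p * q + q) (cyclic_sum (p + q) ?R zs)"
  proof -
    have FG: "pairing (rb_circ scale p q F G) zs = signed (p * q) (?L zs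
        + (\<Sum>i<p. signed (Suc (i + q) * (p + q)) (?L (rotate (Suc (i + q)) zs))))
        - signed (p * q + q) (\<Sum>i<p. signed (Suc (i + q) * (p + q)) (?R (rotate (Suc (i + q)) zs)))"
      by (rule pairing_rb_circ[OF F len])
    have GF: "pairing (rb_circ scale q p G F) zs = signed (p * q) (?R (rotate q zs)
        + (\<Sum>i<q. signed (Suc (i + p) * (p + q)) (?R (rotate i zs))))
        - signed (p * q + p) (\<Sum>i<q. signed (Suc (i + p) * (p + q)) (?L (rotate (Suc i) zs)))"
      using pairing_rb_circ[OF G, of zs p F] len
      by (simp only: L R left_chain_swap[OF len] add.commute[of q p] mult.commute[of q p])
    have sign_R: "signed (p * q) (signed (p * q) (signed (Suc (i + p) * (p + q)) x)) =
        signed (p * q + q) (signed (i * (p + q)) x)" for i and x :: 'k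
      by (cases "even p"; cases "even q"; cases "even i"; simp add: signed_def)
    have sign_L: "signed (p * q) (signed (p * q + p) (signed (Suc (i + p) * (p + q)) x)) =
        signed (p * q) (signed (Suc i * (p + q)) x)" for i and x :: 'k
      by (cases "even p"; cases "even q"; cases "even i"; simp add: signed_def)
    have sign_q: "signed (p * q) (signed (p * q) (?R (rotate q zs))) =
        signed (p * q + q) (signed (q * (p + q)) (?R (rotate q zs)))"
      by (simp add: signed_def)
    show ?thesis
      unfolding FG GF sum_L sum_R signed_add signed_diff signed_sum sign_R sign_L sign_q
      by simp
  qed
  finally show ?thesis .
qed

lemma rb_commutator_Crb:
  assumes F: "F \<in> Crb scale form p" and G: "G \<in> Crb scale form q"
  shows "rb_commutator p q F G \<in> Crb scale form (p + q)"
proof -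
  have "F \<in> Hom scale p" "G \<in> Hom scale q"
    using F G by (simp_all add: Crb_def)
  then show ?thesis
    unfolding Crb_iff
    by (auto simp: Hom_rb_commutator pairing_rb_commutator[OF F G] cyclic_sum_rotate1 signed_diff signed_signed
        add.commute)
qed

end

theorem theorem3p4:
  fixes scale :: "'k::field_char_0 \<Rightarrow> 'a::ring \<Rightarrow> 'a"
    and form :: "'a \<Rightarrow> 'a \<Rightarrow> 'k"
  assumes "symmetric_frobenius_algebra scale form"
    and "\<exists>B. finite_dimensional_vector_space scale B"
  shows "(\<forall>p q. \<forall>F \<in> Crb scale form p. \<forall>G \<in> Crb scale form q.
            rb_bracket_hom scale p q F G \<in> Crb scale form (p + q)) \<and>
         graded_lie_subalgebra (fscale scale) (Hom scale) (rb_bracket scale) (Crb scale form)"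
proof -
  interpret symmetric_frobenius_algebra scale form
    by fact
  interpret L: graded_lie_algebra "fscale scale" "Hom scale" "rb_bracket scale"
    by (rule graded_lie_algebra_Hom)
  let ?M = "\<Union>n. Crb scale form n"
  have Hom: "F \<in> Hom scale n" if "F \<in> Crb scale form n" for F n
    using that by (simp add: Crb_def)
  have span_Hom: "F \<in> L.span (\<Union>n. Hom scale n)" if "F \<in> L.span ?M" for F
    using that L.span_mono[of ?M "\<Union>n. Hom scale n"] Hom by blast
  have subspace: "L.subspace (Crb scale form n)" for n
  proof (rule L.subspaceI)
    show "0 \<in> Crb scale form n"
      using L.subspace_0[OF L.subspace_L] by (simp add: Crb_iff pairing_def form_zero_left)
  next
    fix F G
    assume "F \<in> Crb scale form n" "G \<in> Crb scale form n"
    then show "F + G \<in> Crb scale form n"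
      using L.subspace_add[OF L.subspace_L] by (simp add: Crb_iff pairing_def form_add_left signed_add)
  next
    fix c F
    assume "F \<in> Crb scale form n"
    then show "fscale scale c F \<in> Crb scale form n"
      using L.subspace_scale[OF L.subspace_L]
      by (simp add: Crb_iff pairing_def fscale_apply form_scale_left) (simp add: signed_def)
  qed
  have homogeneous: "rb_bracket scale F G \<in> L.span ?M"
    if "F \<in> Crb scale form p" "G \<in> Crb scale form q" for F G p q
    unfolding rb_bracket_eq_rb_commutator[OF Hom[OF that(1)] Hom[OF that(2)]]
    using rb_commutator_Crb[OF that] by (blast intro: L.span_base)
  \<comment> \<open>Closedness extends from homogeneous elements to the span in one argument after the other. The
    auxiliary subspaces are cut down to the ambient direct sum, outside of which the bracket need not be linear.\<close>
  have left: "rb_bracket scale F G \<in> L.span ?M" if F: "F \<in> L.span ?M" and G: "G \<in> Crb scale form q" for F G q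
  proof -
    have G': "G \<in> L.span (\<Union>n. Hom scale n)"
      using G Hom by (blast intro: L.span_base)
    have "L.subspace {F \<in> L.span (\<Union>n. Hom scale n). rb_bracket scale F G \<in> L.span ?M}"
      using G' L.br_scale_left[OF L.span_zero G', of 0]
      by (intro L.subspaceI) (auto simp: L.br_add_left L.br_scale_left L.span_add L.span_scale L.span_zero)
    then have "L.span ?M \<subseteq> {F \<in> L.span (\<Union>n. Hom scale n). rb_bracket scale F G \<in> L.span ?M}"
      using G by (intro L.span_minimal) (auto intro: homogeneous L.span_base Hom)
    then show ?thesis
      using F by blast
  qed
  have "rb_bracket scale F G \<in> L.span ?M" if F: "F \<in> L.span ?M" and G: "G \<in> L.span ?M" for F G
  proof -
    note F' = span_Hom[OF F]
    have "L.subspace {G \<in> L.span (\<Union>n. Hom scale n). rb_bracket scale F G \<in> L.span ?M}"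
      using F' L.br_scale_right[OF F' L.span_zero, of 0]
      by (intro L.subspaceI) (auto simp: L.br_add_right L.br_scale_right L.span_add L.span_scale L.span_zero)
    then have "L.span ?M \<subseteq> {G \<in> L.span (\<Union>n. Hom scale n). rb_bracket scale F G \<in> L.span ?M}"
      by (intro L.span_minimal) (auto intro: left[OF F] L.span_base Hom)
    then show ?thesis
      using G by blast
  qed
  then have "graded_lie_subalgebra (fscale scale) (Hom scale) (rb_bracket scale) (Crb scale form)"
    by unfold_locales (use subspace Hom in blast)+
  moreover have "rb_bracket_hom scale p q F G \<in> Crb scale form (p + q)"
    if "F \<in> Crb scale form p" "G \<in> Crb scale form q" for F G p q
    using rb_commutator_Crb[OF that] by (simp only: rb_bracket_hom_eq_rb_commutator[OF Hom Hom] that)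
  ultimately show ?thesis
    by blast
qed

end
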